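(* Let $k\geq1$, $n\geq1$ and $1\leq j\leq n$. The number of $k$-box paths of size $n$ with exactly $j$ long ascents is \[\acute{f}_{k,n,j}=\frac{1}{j}\binom{(k+1)n-2}{j-1}\binom{n-1}{j-1}.\]
   Context: A skew Dyck path is a word $w$ over $\{U,D,L\}$ such that: $w$ contains neither $UL$ nor $LU$ as a contiguous subword; the number of $U$s equals the total number of $D$s and $L$s; and in every prefix the total number of $D$s and $L$s is at most the number of $U$s. Its semilength is its number of $U$s. A factor is a contiguous subword; $X^{m}$ denotes $m$ consecutive copies of $X$. For $k\geq1$, a $k$-box path of size $n$ is a skew Dyck path of semilength $(k+2)n-1$ containing exactly $n$ occurrences of the factor $UD^{k}L$. An ascent is a maximal run of consecutive $U$s; a long ascent is an ascent consisting of at least two $U$s. *)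

theory Defs
  imports Complex_Main "HOL-Library.Sublist"
begin

datatype step = U | D | L

definition skew_dyck_path :: "step list \<Rightarrow> bool" where
  "skew_dyck_path w \<longleftrightarrow>
     \<not> sublist [U, L] w \<and> \<not> sublist [L, U] w \<and>
     count_list w U = count_list w D + count_list w L \<and>
     (\<forall>p. prefix p w \<longrightarrow> count_list p D + count_list p L \<le> count_list p U)"

definition semilength :: "step list \<Rightarrow> nat" where
  "semilength w = count_list w U"

text \<open>An occurrence of a factor is identified with the pair of words surrounding it.\<close>

definition factor_occurrences :: "'a list \<Rightarrow> 'a list \<Rightarrow> ('a list \<times> 'a list) set" where
  "factor_occurrences f w = {(p, s). w = p @ f @ s}"

definition box_path :: "nat \<Rightarrow> nat \<Rightarrow> step list \<Rightarrow> bool" where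
  "box_path k n w \<longleftrightarrow>
     skew_dyck_path w \<and> semilength w = (k + 2) * n - 1 \<and>
     card (factor_occurrences ([U] @ replicate k D @ [L]) w) = n"

text \<open>A triple \<open>(p, m, s)\<close> is the ascent of length \<open>m\<close> preceded by \<open>p\<close> and followed by \<open>s\<close>;
  the last two conditions express maximality of the run.\<close>

definition ascents :: "step list \<Rightarrow> (step list \<times> nat \<times> step list) set" where
  "ascents w = {(p, m, s). w = p @ replicate m U @ s \<and> m \<ge> 1 \<and>
     (p = [] \<or> last p \<noteq> U) \<and> (s = [] \<or> hd s \<noteq> U)}"

definition long_ascents :: "step list \<Rightarrow> (step list \<times> nat \<times> step list) set" where
  "long_ascents w = {(p, m, s) \<in> ascents w. m \<ge> 2}"

end

(* A k-box path of size n becomes, after appending one D, a concatenation of n blocks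
   U^a U D^k L D with a_1 + ... + a_n = (k+1)n - 1, where a block has a long ascent iff a > 0.
   The path condition says that the partial sums of the a_i - (k+1), whose total is -1, are
   nonnegative before the end; by the cycle lemma exactly one rotation in n satisfies it.
   The sequences with j nonzero entries number C(n,j) C((k+1)n-2, j-1). *)

theory Submission
  imports Defs
begin

section \<open>The cycle lemma\<close>

text \<open>Heights need checking only between blocks, since a block first rises and then falls. The
  appended D supplies the step after the last L and is the only step that takes the path to height
  -1; hence the total -1, for which exactly one rotation is good. Blocks with a = 0 stay in the
  lists, so that rotation acts on all n blocks and keeps the number of long ascents. The factor 1/n
  from the rotations turns into 1/j through j C(n,j) = n C(n-1,j-1).\<close>

definition nonneg_partial_sums :: "('a \<Rightarrow> int) \<Rightarrow> 'a list \<Rightarrow> bool" where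
  "nonneg_partial_sums f xs \<longleftrightarrow> (\<forall>i<length xs. 0 \<le> sum_list (map f (take i xs)))"

lemma sum_list_map_take_drop:
  fixes f :: "'a \<Rightarrow> 'b::monoid_add"
  shows "sum_list (map f xs) = sum_list (map f (take r xs)) + sum_list (map f (drop r xs))"
  by (metis append_take_drop_id map_append sum_list_append)

text \<open>If 0 < t < \<open>length xs\<close>, cutting at t splits the negative total into a
  proper partial sum of \<open>xs\<close> and a proper partial sum of the rotated list; both cannot
  be nonnegative.\<close>

lemma nonneg_partial_sums_rotate_imp_zero:
  fixes f :: "'a \<Rightarrow> int"
  assumes "nonneg_partial_sums f xs" "nonneg_partial_sums f (rotate t xs)"
    and "sum_list (map f xs) < 0" "t < length xs"
  shows "t = 0"
proof (rule ccontr)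
  assume "t \<noteq> 0"
  have rot: "rotate t xs = drop t xs @ take t xs"
    using assms(4) by (simp add: rotate_drop_take)
  have "0 \<le> sum_list (map f (take (length xs - t) (rotate t xs)))"
    using assms(2,4) \<open>t \<noteq> 0\<close> unfolding nonneg_partial_sums_def by simp
  then have "0 \<le> sum_list (map f (drop t xs))"
    by (simp add: rot)
  moreover have "0 \<le> sum_list (map f (take t xs))"
    using assms(1,4) unfolding nonneg_partial_sums_def by simp
  ultimately show False
    using assms(3) sum_list_map_take_drop[of f xs t] by simp
qed

lemma rotate_eq_rotateD:
  assumes "rotate r xs = rotate s ys" "r \<le> s" "r \<le> length xs"
  shows "xs = rotate (s - r) ys"
proof -
  let ?n = "length xs"
  have len: "length ys = ?n"
    using assms(1) by (metis length_rotate)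
  have "xs = rotate (?n - r) (rotate r xs)"
    using assms(3) by (simp add: rotate_rotate)
  also have "\<dots> = rotate (?n - r + s) ys"
    by (simp add: assms(1) rotate_rotate)
  also have "?n - r + s = (s - r) + ?n"
    using assms by simp
  also have "rotate ((s - r) + ?n) ys = rotate (s - r) ys"
    using len by (simp flip: rotate_rotate)
  finally show ?thesis .
qed

text \<open>Rotating to the leftmost minimum of the partial sums makes all proper partial sums
  nonnegative.\<close>

lemma ex_rotate_nonneg_partial_sums:
  fixes f :: "'a \<Rightarrow> int"
  assumes sum: "sum_list (map f xs) = -1"
  shows "\<exists>r<length xs. nonneg_partial_sums f (rotate r xs)"
proof -
  let ?n = "length xs"
  define S where "S i = sum_list (map f (take i xs))" for i
  define r where "r = (LEAST i. i \<le> ?n \<and> (\<forall>l\<le>?n. S i \<le> S l))"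
  have "\<exists>i. i \<le> ?n \<and> (\<forall>l\<le>?n. S i \<le> S l)"
  proof -
    have "Min (S ` {..?n}) \<in> S ` {..?n}"
      by (intro Min_in) auto
    then obtain i where "i \<in> {..?n}" and i: "Min (S ` {..?n}) = S i"
      by (rule imageE)
    moreover have "S i \<le> S l" if "l \<le> ?n" for l
      using that by (simp flip: i)
    ultimately show ?thesis
      by auto
  qed
  then have "r \<le> ?n \<and> (\<forall>l\<le>?n. S r \<le> S l)"
    unfolding r_def by (rule LeastI_ex)
  then have r: "r \<le> ?n" "\<And>l. l \<le> ?n \<Longrightarrow> S r \<le> S l"
    by auto
  \<comment> \<open>Before the leftmost minimum the sums exceed it by at least 1, being integers;
    this pays for the total -1 when the rotated list wraps around.\<close>
  have less: "S r < S l" if "l < r" for l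
  proof -
    have "\<not> (l \<le> ?n \<and> (\<forall>m\<le>?n. S l \<le> S m))"
      using that not_less_Least unfolding r_def by blast
    then show ?thesis
      using that r by force
  qed
  have rot: "rotate r xs = drop r xs @ take r xs"
    using r(1) by (cases "r = ?n") (simp_all add: rotate_drop_take)
  have total: "S ?n = -1"
    using sum by (simp add: S_def)
  have drop: "sum_list (map f (take i (drop r xs))) = S (r + i) - S r" for i
    by (simp add: S_def take_add)
  have "nonneg_partial_sums f (rotate r xs)"
    unfolding nonneg_partial_sums_def
  proof (intro allI impI)
    fix i assume i: "i < length (rotate r xs)"
    show "0 \<le> sum_list (map f (take i (rotate r xs)))"
    proof (cases "i \<le> ?n - r")
      case True
      then have "sum_list (map f (take i (rotate r xs))) = S (r + i) - S r"
        by (simp add: rot drop)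
      then show ?thesis
        using r True by (simp add: add.commute)
    next
      case False
      define l where "l = i - (?n - r)"
      have l: "l < r"
        using False i r(1) by (simp add: l_def)
      have "sum_list (map f (take i (rotate r xs))) = (S ?n - S r) + S l"
        using False l drop[of "?n - r"] r(1)
        by (simp add: rot S_def l_def min_def)
      then show ?thesis
        using less[OF l] total by simp
    qed
  qed
  moreover have "xs \<noteq> []"
    using sum by auto
  \<comment> \<open>The leftmost minimum may lie at the very end, r = \<open>?n\<close>; hence the
    reduction modulo the length.\<close>
  ultimately show ?thesis
    by (intro exI[of _ "r mod ?n"]) (simp flip: rotate_conv_mod)
qed

text \<open>Rotation maps pairs of an offset below n and a good list bijectively onto
  \<open>A\<close>: a good rotation exists, and its uniqueness gives injectivity. Uniqueness also
  separates the n rotations of one good list, so periodic lists need no extra care.\<close>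

lemma cycle_lemma:
  fixes f :: "'a \<Rightarrow> int"
  assumes len: "\<And>xs. xs \<in> A \<Longrightarrow> length xs = n"
    and sum: "\<And>xs. xs \<in> A \<Longrightarrow> sum_list (map f xs) = -1"
    and rot: "\<And>xs r. xs \<in> A \<Longrightarrow> rotate r xs \<in> A"
  shows "card A = n * card {xs \<in> A. nonneg_partial_sums f xs}"
proof -
  let ?B = "{xs \<in> A. nonneg_partial_sums f xs}"
  have eq: "r = s \<and> xs = ys"
    if "xs \<in> ?B" "ys \<in> ?B" "rotate r xs = rotate s ys" "r \<le> s" "r < n" "s < n" for r s xs ys
  proof -
    have xs: "xs = rotate (s - r) ys"
      using that len by (intro rotate_eq_rotateD) auto
    moreover have "s - r = 0"
    proof (rule nonneg_partial_sums_rotate_imp_zero)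
      show "nonneg_partial_sums f ys" "nonneg_partial_sums f (rotate (s - r) ys)"
        using that(1,2) xs by auto
    qed (use that len sum in auto)
    ultimately show ?thesis
      using that(4) by simp
  qed
  have "bij_betw (\<lambda>(r, xs). rotate r xs) ({..<n} \<times> ?B) A"
    unfolding bij_betw_def
  proof (intro conjI inj_onI set_eqI iffI)
    fix p q assume "p \<in> {..<n} \<times> ?B" "q \<in> {..<n} \<times> ?B"
      and "(\<lambda>(r, xs). rotate r xs) p = (\<lambda>(r, xs). rotate r xs) q"
    then show "p = q"
      using eq[of "snd p" "snd q" "fst p" "fst q"] eq[of "snd q" "snd p" "fst q" "fst p"]
      by (cases "fst p \<le> fst q") (auto simp: prod_eq_iff case_prod_beta)
  next
    fix ys assume "ys \<in> (\<lambda>(r, xs). rotate r xs) ` ({..<n} \<times> ?B)"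
    then show "ys \<in> A"
      using rot by auto
  next
    fix ys assume ys: "ys \<in> A"
    then obtain r where r: "r < n" "nonneg_partial_sums f (rotate r ys)"
      using ex_rotate_nonneg_partial_sums[OF sum] len by metis
    \<comment> \<open>For r = 0 the inverse offset n - r would be n, which is out of range.\<close>
    have "rotate ((n - r) mod n) (rotate r ys) = rotate (n - r) (rotate r ys)"
      using len[OF ys] by (metis length_rotate rotate_conv_mod)
    also have "\<dots> = ys"
      using r len[OF ys] by (simp add: rotate_rotate)
    finally have "rotate ((n - r) mod n) (rotate r ys) = ys" .
    moreover have "(n - r) mod n < n"
      using r by simp
    ultimately show "ys \<in> (\<lambda>(r, xs). rotate r xs) ` ({..<n} \<times> ?B)"
      using r rot[OF ys] by (intro image_eqI[of _ _ "((n - r) mod n, rotate r ys)"]) auto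
  qed
  then show ?thesis
    by (auto dest!: bij_betw_same_card simp: card_cartesian_product)
qed

section \<open>Lists with a given sum and a given number of nonzero entries\<close>

definition num_nonzero :: "nat list \<Rightarrow> nat" where
  "num_nonzero xs = length (filter (\<lambda>a. a \<noteq> 0) xs)"

lemma num_nonzero_simps [simp]:
  "num_nonzero [] = 0"
  "num_nonzero (x # xs) = (if x = 0 then 0 else 1) + num_nonzero xs"
  by (simp_all add: num_nonzero_def)

definition weak_comps :: "nat \<Rightarrow> nat \<Rightarrow> nat \<Rightarrow> nat list set" where
  "weak_comps n N j = {xs. length xs = n \<and> sum_list xs = N \<and> num_nonzero xs = j}"

lemma finite_weak_comps: "finite (weak_comps n N j)"
proof (rule finite_subset)
  show "weak_comps n N j \<subseteq> {xs. set xs \<subseteq> {..N} \<and> length xs = n}"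
    using member_le_sum_list by (fastforce simp: weak_comps_def)
qed (simp add: finite_lists_length_eq)

lemma num_nonzero_eq_0_iff: "num_nonzero xs = 0 \<longleftrightarrow> sum_list xs = 0"
  by (induction xs) auto

lemma weak_comps_rotate:
  assumes "xs \<in> weak_comps n N j"
  shows "rotate r xs \<in> weak_comps n N j"
proof -
  let ?m = "r mod length xs"
  have "sum_list (rotate r xs) = sum_list (take ?m xs @ drop ?m xs)"
    unfolding rotate_drop_take sum_list_append by (rule add.commute)
  moreover have "num_nonzero (rotate r xs) = num_nonzero (take ?m xs @ drop ?m xs)"
    unfolding rotate_drop_take num_nonzero_def filter_append length_append by (rule add.commute)
  ultimately show ?thesis
    using assms by (simp add: weak_comps_def)
qed

lemma card_weak_comps_zero: "card (weak_comps n N 0) = (if N = 0 then 1 else 0)"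
proof -
  have "weak_comps n 0 0 = {replicate n 0}"
    by (auto simp: weak_comps_def num_nonzero_eq_0_iff intro: replicate_eqI)
  moreover have "weak_comps n N 0 = {}" if "N \<noteq> 0"
    using that num_nonzero_eq_0_iff by (auto simp: weak_comps_def simp del: sum_list_eq_0_iff)
  ultimately show ?thesis
    by simp
qed

text \<open>Split by the first entry: it is 0, or it is N - M > 0 in front of a tail of sum M, which
  has one nonzero entry fewer.\<close>

lemma card_weak_comps_Suc:
  "card (weak_comps (Suc n) N (Suc j)) =
    card (weak_comps n N (Suc j)) + (\<Sum>M<N. card (weak_comps n M j))"
proof -
  have "weak_comps (Suc n) N (Suc j) =
      (#) 0 ` weak_comps n N (Suc j) \<union> (\<Union>M<N. (#) (N - M) ` weak_comps n M j)"
    (is "?A = ?B \<union> ?C")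
  proof (intro set_eqI iffI)
    fix xs assume "xs \<in> ?A"
    then obtain y ys where xs: "xs = y # ys" "length ys = n" "y + sum_list ys = N"
      "num_nonzero (y # ys) = Suc j"
      by (auto simp: weak_comps_def length_Suc_conv)
    show "xs \<in> ?B \<union> ?C"
    proof (cases "y = 0")
      case True
      then show ?thesis
        using xs by (auto simp: weak_comps_def)
    next
      case False
      then have "sum_list ys < N" "xs = (N - sum_list ys) # ys" "ys \<in> weak_comps n (sum_list ys) j"
        using xs by (auto simp: weak_comps_def)
      then show ?thesis
        by blast
    qed
  qed (auto simp: weak_comps_def)
  moreover have "card (?B \<union> ?C) = card ?B + card ?C"
    by (rule card_Un_disjoint) (auto simp: finite_weak_comps)
  moreover have "card ?C = (\<Sum>M<N. card ((#) (N - M) ` weak_comps n M j))"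
    by (rule card_UN_disjoint) (auto simp: finite_weak_comps)
  ultimately show ?thesis
    by (simp add: card_image)
qed

text \<open>Choose the positions of the nonzero entries, then a composition of \<open>Suc N\<close>
  into \<open>Suc j\<close> positive parts. The induction replaces these choices by Pascal's rule in
  n.\<close>

lemma card_weak_comps:
  "card (weak_comps n (Suc N) (Suc j)) = (n choose Suc j) * (N choose j)"
proof (induction n arbitrary: N j)
  case 0
  show ?case
    by (simp add: weak_comps_def)
next
  case (Suc n)
  have "(\<Sum>M<Suc N. card (weak_comps n M j)) = (n choose j) * (N choose j)"
  proof (cases j)
    case 0
    then show ?thesis
      by (simp add: card_weak_comps_zero sum.delta')
  next
    case (Suc i)
    \<comment> \<open>Positive j excludes sum 0, so the summation can be shifted to the form of the
      induction hypothesis.\<close>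
    have "weak_comps n 0 j = {}"
      by (auto simp: Suc weak_comps_def simp del: sum_list_eq_0_iff simp flip: num_nonzero_eq_0_iff)
    then have "(\<Sum>M<Suc N. card (weak_comps n M j)) = (\<Sum>M<N. card (weak_comps n (Suc M) j))"
      by (simp add: sum.lessThan_Suc_shift del: sum.lessThan_Suc)
    also have "\<dots> = (n choose j) * (\<Sum>M<N. M choose i)"
      by (simp add: Suc Suc.IH sum_distrib_left)
    \<comment> \<open>This is the hockey-stick identity for column i of Pascal's triangle.\<close>
    also have "(\<Sum>M<N. M choose i) = N choose j"
      unfolding Suc by (induction N) simp_all
    finally show ?thesis .
  qed
  then show ?case
    by (simp add: card_weak_comps_Suc Suc.IH algebra_simps)
qed

section \<open>Occurrences of a factor\<close>

lemma finite_factor_occurrences: "finite (factor_occurrences f w)"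
proof (rule finite_subset)
  show "factor_occurrences f w \<subseteq> set (prefixes w) \<times> set (suffixes w)"
    by (auto simp: factor_occurrences_def suffix_def)
qed simp

lemma card_factor_occurrences_Nil:
  "f \<noteq> [] \<Longrightarrow> card (factor_occurrences f []) = 0"
  by (simp add: factor_occurrences_def)

text \<open>An occurrence has an empty left context, which leaves at most one, or comes from
  \<open>w\<close> by extending its left context by \<open>x\<close>.\<close>

lemma card_factor_occurrences_Cons:
  fixes f :: "'a list"
  assumes "f \<noteq> []"
  shows "card (factor_occurrences f (x # w)) =
    (if prefix f (x # w) then 1 else 0) + card (factor_occurrences f w)"
proof -
  let ?A = "{([] :: 'a list, s) | s. x # w = f @ s}"
    and ?B = "(\<lambda>(p, s). (x # p, s)) ` factor_occurrences f w"
  have "factor_occurrences f (x # w) = ?A \<union> ?B"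
    using assms by (auto simp: factor_occurrences_def Cons_eq_append_conv)
  moreover have "card (?A \<union> ?B) = card ?A + card ?B"
  proof (rule card_Un_disjoint)
    show "finite ?A"
      by (rule finite_subset[OF _ finite_factor_occurrences[of f "x # w"]])
        (auto simp: factor_occurrences_def)
  qed (auto simp: finite_factor_occurrences)
  moreover have "?A = (if prefix f (x # w) then {([], drop (length f) (x # w))} else {})"
    by (auto simp: prefix_def)
  moreover have "card ?B = card (factor_occurrences f w)"
    by (rule card_image) (auto simp: inj_on_def)
  ultimately show ?thesis
    by simp
qed

text \<open>An occurrence reaching the appended letter would end in it. As the box factor ends in L,
  a path and its extension by D have the same count.\<close>

lemma card_factor_occurrences_snoc:
  assumes "f \<noteq> []" "last f \<noteq> x"
  shows "card (factor_occurrences f (w @ [x])) = card (factor_occurrences f w)"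
proof -
  have "factor_occurrences f (w @ [x]) = (\<lambda>(p, s). (p, s @ [x])) ` factor_occurrences f w"
  proof (intro set_eqI iffI)
    fix o' assume "o' \<in> factor_occurrences f (w @ [x])"
    then obtain p s where o': "o' = (p, s)" "w @ [x] = p @ f @ s"
      by (auto simp: factor_occurrences_def)
    show "o' \<in> (\<lambda>(p, s). (p, s @ [x])) ` factor_occurrences f w"
    proof (cases s rule: rev_cases)
      case Nil
      then have "last (w @ [x]) = last f"
        using o' assms(1) by simp
      then show ?thesis
        using assms(2) by simp
    next
      case (snoc s' y)
      then show ?thesis
        using o' by (auto simp: factor_occurrences_def intro!: image_eqI[of _ _ "(p, s')"])
    qed
  qed (auto simp: factor_occurrences_def)
  then show ?thesis
    by (auto intro: card_image simp: inj_on_def)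
qed

section \<open>Long ascents\<close>

lemma finite_long_ascents: "finite (long_ascents w)"
proof (rule finite_subset)
  show "long_ascents w \<subseteq> set (prefixes w) \<times> {..length w} \<times> set (suffixes w)"
    by (auto simp: long_ascents_def ascents_def suffix_def)
qed simp

lemma card_long_ascents_Nil: "card (long_ascents []) = 0"
proof -
  have "long_ascents [] = {}"
    by (auto simp: long_ascents_def ascents_def)
  then show ?thesis
    by simp
qed

text \<open>A letter other than U starts no ascent, and in front of an ascent it meets the
  maximality condition just as the empty prefix does.\<close>

lemma card_long_ascents_Cons:
  assumes "x \<noteq> U"
  shows "card (long_ascents (x # w)) = card (long_ascents w)"
proof -
  have "long_ascents (x # w) = (\<lambda>(p, m, s). (x # p, m, s)) ` long_ascents w"
  proof (intro set_eqI iffI)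
    fix o' assume o': "o' \<in> long_ascents (x # w)"
    obtain p m s where [simp]: "o' = (p, m, s)"
      by (cases o')
    have "p \<noteq> []"
      using o' assms by (cases m) (auto simp: long_ascents_def ascents_def)
    then obtain p' where "p = x # p'"
      using o' by (cases p) (auto simp: long_ascents_def ascents_def)
    then show "o' \<in> (\<lambda>(p, m, s). (x # p, m, s)) ` long_ascents w"
      using o' by (auto simp: long_ascents_def ascents_def intro!: image_eqI[of _ _ "(p', m, s)"]
          split: if_splits)
  qed (use assms in \<open>auto simp: long_ascents_def ascents_def split: if_splits\<close>)
  then show ?thesis
    by (auto intro: card_image simp: inj_on_def)
qed

text \<open>\<open>takeWhile\<close> reads off the initial run. This identifies the first ascent of
  a word and later decodes words of blocks in \<open>inj_blocks\<close>.\<close>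

lemma replicate_append_eqD:
  assumes "replicate m x @ v = replicate l x @ s"
    and "v = [] \<or> hd v \<noteq> x" "s = [] \<or> hd s \<noteq> x"
  shows "m = l \<and> v = s"
proof -
  have tw: "takeWhile (\<lambda>y. y = x) (replicate i x @ u) = replicate i x"
    if "u = [] \<or> hd u \<noteq> x" for i u
    using that by (induction i) (cases u, simp_all)
  have "replicate m x = replicate l x"
    using tw[OF assms(2), of m] tw[OF assms(3), of l] assms(1) by simp
  then have "m = l"
    by (metis length_replicate)
  then show ?thesis
    using assms(1) by simp
qed

lemma card_long_ascents_replicate:
  assumes "x \<noteq> U"
  shows "card (long_ascents (replicate (Suc a) U @ x # w)) =
    (if a = 0 then 0 else 1) + card (long_ascents (x # w))"
proof -
  let ?w = "replicate (Suc a) U @ x # w"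
  let ?A = "if a = 0 then {} else {([] :: step list, Suc a, x # w)}"
    and ?B = "(\<lambda>(p, m, s). (replicate (Suc a) U @ p, m, s)) ` long_ascents (x # w)"
  have "long_ascents ?w = ?A \<union> ?B"
  proof (intro set_eqI iffI)
    fix o' assume o': "o' \<in> long_ascents ?w"
    obtain p m s where [simp]: "o' = (p, m, s)"
      by (cases o')
    have *: "?w = p @ replicate m U @ s" "m \<ge> 2" "p = [] \<or> last p \<noteq> U" "s = [] \<or> hd s \<noteq> U"
      using o' by (auto simp: long_ascents_def ascents_def)
    show "o' \<in> ?A \<union> ?B"
    proof (cases "p = []")
      case True
      then have "Suc a = m \<and> x # w = s"
        using * assms by (intro replicate_append_eqD) auto
      then show ?thesis
        using True *(2) by auto
    next
      case False
      \<comment> \<open>A nonempty \<open>p\<close> within the leading run would end in U, against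
        maximality.\<close>
      have "\<not> prefix p (replicate (Suc a) U)"
      proof
        assume "prefix p (replicate (Suc a) U)"
        then have "set p \<subseteq> {U}"
          using set_mono_prefix by fastforce
        then show False
          using False *(3) last_in_set by fastforce
      qed
      moreover have "prefix p ?w"
        unfolding *(1) by simp
      ultimately obtain p' where p': "p = replicate (Suc a) U @ p'"
        unfolding prefix_append by blast
      then have "p' \<noteq> []"
        using *(3) False by (auto simp flip: replicate_append_same)
      then have "(p', m, s) \<in> long_ascents (x # w)"
        using * p' by (auto simp: long_ascents_def ascents_def)
      then show ?thesis
        using p' by (auto intro!: image_eqI[of _ _ "(p', m, s)"])
    qed
  next
    fix o' assume o': "o' \<in> ?A \<union> ?B"
    have "(replicate (Suc a) U @ p, m, s) \<in> long_ascents ?w"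
      if "(p, m, s) \<in> long_ascents (x # w)" for p m s
    proof -
      have *: "x # w = p @ replicate m U @ s" "m \<ge> 2" "p = [] \<or> last p \<noteq> U" "s = [] \<or> hd s \<noteq> U"
        using that by (auto simp: long_ascents_def ascents_def)
      \<comment> \<open>A nonempty \<open>p\<close> keeps its last letter when the run is put in
        front; with \<open>p = []\<close> the ascent would lose its maximality.\<close>
      then have "p \<noteq> []"
        using assms by (cases m) auto
      then show ?thesis
        using * by (simp add: long_ascents_def ascents_def)
    qed
    moreover have "([], Suc a, x # w) \<in> long_ascents ?w" if "a \<noteq> 0"
      using that assms by (auto simp: long_ascents_def ascents_def)
    ultimately show "o' \<in> long_ascents ?w"
      using o' by (auto split: if_splits)
  qed
  moreover have "card (?A \<union> ?B) = card ?A + card ?B"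
    by (rule card_Un_disjoint) (auto simp: finite_long_ascents)
  moreover have "card ?B = card (long_ascents (x # w))"
    by (rule card_image) (auto simp: inj_on_def)
  ultimately show ?thesis
    by simp
qed

lemma card_long_ascents_snoc:
  assumes "x \<noteq> U"
  shows "card (long_ascents (w @ [x])) = card (long_ascents w)"
proof -
  have "long_ascents (w @ [x]) = (\<lambda>(p, m, s). (p, m, s @ [x])) ` long_ascents w"
  proof (intro set_eqI iffI)
    fix o' assume o': "o' \<in> long_ascents (w @ [x])"
    obtain p m s where [simp]: "o' = (p, m, s)"
      by (cases o')
    have *: "w @ [x] = p @ replicate m U @ s" "m \<ge> 2" "p = [] \<or> last p \<noteq> U" "s = [] \<or> hd s \<noteq> U"
      using o' by (auto simp: long_ascents_def ascents_def)
    show "o' \<in> (\<lambda>(p, m, s). (p, m, s @ [x])) ` long_ascents w"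
    proof (cases s rule: rev_cases)
      case Nil
      then have "last (w @ [x]) = U"
        using * by (simp add: last_append)
      then show ?thesis
        using assms by simp
    next
      case (snoc s' y)
      then have "(p, m, s') \<in> long_ascents w" "s = s' @ [x]"
        using * by (auto simp: long_ascents_def ascents_def hd_append split: if_splits)
      then show ?thesis
        by (auto intro!: image_eqI[of _ _ "(p, m, s')"])
    qed
  qed (use assms in \<open>auto simp: long_ascents_def ascents_def hd_append split: if_splits\<close>)
  then show ?thesis
    by (auto intro: card_image simp: inj_on_def)
qed
section \<open>Box paths as sequences of blocks\<close>

text \<open>An occurrence of the factor cannot be followed by \<open>U\<close>, so every occurrence but the last one
  uses up an extra down step. A path with exactly \<open>n\<close> occurrences has just \<open>n - 1\<close> extra down
  steps, hence after appending one \<open>D\<close> it is a concatenation of blocks \<open>U\<^sup>a U D\<^sup>k L D\<close>.\<close>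

definition block :: "nat \<Rightarrow> nat \<Rightarrow> step list" where
  "block k a = replicate (Suc a) U @ replicate k D @ [L, D]"

lemma block_append:
  "block k a @ w = replicate (Suc a) U @ replicate k D @ [L, D] @ w"
  by (simp only: block_def append_assoc)

abbreviation blocks :: "nat \<Rightarrow> nat list \<Rightarrow> step list" where
  "blocks k as \<equiv> concat (map (block k) as)"

abbreviation box_factor :: "nat \<Rightarrow> step list" where
  "box_factor k \<equiv> U # replicate k D @ [L]"

section \<open>Heights and numbers of down steps\<close>

definition downs :: "step list \<Rightarrow> nat" where
  "downs w = count_list w D + count_list w L"

definition height :: "step list \<Rightarrow> int" where
  "height w = int (count_list w U) - int (downs w)"

text \<open>Net height of a block: a + 1 up steps against k + 2 down steps.\<close>

definition excess :: "nat \<Rightarrow> nat \<Rightarrow> int" where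
  "excess k a = int a - int (k + 1)"

lemma count_list_replicate: "count_list (replicate m x) y = (if x = y then m else 0)"
  by (induction m) auto

lemma downs_simps [simp]:
  "downs [] = 0"
  "downs (x # w) = (if x = U then 0 else 1) + downs w"
  "downs (v @ w) = downs v + downs w"
  "downs (replicate m x) = (if x = U then 0 else m)"
  by (cases x; simp add: downs_def count_list_replicate)+

lemma height_simps [simp]:
  "height [] = 0"
  "height (x # w) = (if x = U then 1 else -1) + height w"
  "height (v @ w) = height v + height w"
  "height (replicate m x) = (if x = U then int m else - int m)"
  by (simp_all add: height_def count_list_replicate)

lemma downs_eq_length: "U \<notin> set w \<Longrightarrow> downs w = length w"
  by (induction w) auto

lemma height_block: "height (block k a) = excess k a"
  by (simp add: block_def excess_def)

lemma height_blocks: "height (blocks k as) = sum_list (map (excess k) as)"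
  by (induction as) (simp_all add: height_block)

lemma sum_list_excess:
  "sum_list (map (excess k) as) = int (sum_list as) - int ((k + 1) * length as)"
  by (induction as) (simp_all add: excess_def algebra_simps)

lemma count_U_blocks: "count_list (blocks k as) U = sum_list as + length as"
  by (induction as) (simp_all add: block_def count_list_replicate)

section \<open>Occurrences of the factor in words of blocks\<close>

lemma card_box_factor_down:
  "x \<noteq> U \<Longrightarrow> card (factor_occurrences (box_factor k) (x # w)) =
    card (factor_occurrences (box_factor k) w)"
  by (simp add: card_factor_occurrences_Cons)

lemma card_box_factor_replicate_D:
  "card (factor_occurrences (box_factor k) (replicate m D @ w)) =
    card (factor_occurrences (box_factor k) w)"
  by (induction m) (simp_all add: card_box_factor_down)

lemma card_box_factor_U_Cons:
  "card (factor_occurrences (box_factor k) (U # replicate k D @ L # w)) =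
    Suc (card (factor_occurrences (box_factor k) w))"
  by (simp add: card_factor_occurrences_Cons[where x = U] card_box_factor_replicate_D
      card_box_factor_down)

text \<open>The extra U's start no occurrence because the factor never begins with UU, and the down
  steps of the block start none either.\<close>

lemma card_box_factor_block:
  "card (factor_occurrences (box_factor k) (block k a @ w)) =
    Suc (card (factor_occurrences (box_factor k) w))"
proof (induction a)
  case 0
  show ?case
    by (simp add: block_def card_box_factor_U_Cons card_box_factor_down)
next
  case (Suc a)
  have "\<not> prefix (box_factor k) (U # U # v)" for v
    by (cases k) simp_all
  then show ?case
    using Suc by (simp add: block_def card_factor_occurrences_Cons[where x = U])
qed

lemma card_box_factor_blocks:
  "card (factor_occurrences (box_factor k) (blocks k as)) = length as"
  by (induction as) (simp_all add: card_box_factor_block card_factor_occurrences_Nil)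

section \<open>Absence of the factors UL and LU\<close>

text \<open>In this form, avoidance in a concatenation needs a check only at the joint.\<close>

lemma not_sublist_pair_iff:
  "\<not> sublist [x, y] w \<longleftrightarrow> successively (\<lambda>a b. \<not> (a = x \<and> b = y)) w"
proof (induction w)
  case (Cons a w)
  then show ?case
    by (cases w) (auto simp: sublist_Cons_right)
qed simp

lemma hd_blocks: "as \<noteq> [] \<Longrightarrow> blocks k as \<noteq> [] \<and> hd (blocks k as) = U"
  by (cases as) (simp_all add: block_def)

lemma last_blocks: "as \<noteq> [] \<Longrightarrow> last (blocks k as) = D"
  by (cases as rule: rev_cases) (simp_all add: block_def)

lemma successively_replicate: "P x x \<Longrightarrow> successively P (replicate m x)"
  by (induction m rule: induct_nat_012) auto

text \<open>The six pairs are all that can be adjacent: k >= 1 keeps UL out, and the D closing each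
  block keeps LU out.\<close>

lemma successively_blocks:
  assumes "k \<ge> 1" "P U U" "P U D" "P D D" "P D L" "P L D" "P D U"
  shows "successively P (blocks k as)"
proof (induction as)
  case (Cons a as)
  have "successively P (block k a)"
    using assms unfolding block_def
    by (auto simp: successively_append_iff successively_replicate simp del: replicate.simps)
  moreover have "last (block k a) = D"
    by (simp add: block_def)
  ultimately show ?case
    using Cons assms hd_blocks[of as k] by (cases "as = []") (auto simp: successively_append_iff)
qed simp

lemma sublist_pair_blocks:
  assumes "k \<ge> 1"
  shows "\<not> sublist [U, L] (blocks k as)" "\<not> sublist [L, U] (blocks k as)"
  using assms unfolding not_sublist_pair_iff by (auto intro!: successively_blocks)

text \<open>Each occurrence owns its k + 1 down steps and the step after its L, which exists because
  the word does not end in L and is no U because LU is forbidden. In the equality case no other down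
  step is left, so the remaining U's lengthen the next ascent or form the trailing run. Equality is
  inherited by the remaining suffix, so one induction proves both claims.\<close>

lemma box_factors_le_downs:
  assumes "\<not> sublist [L, U] w" "w = [] \<or> last w \<noteq> L"
  shows "(k + 2) * card (factor_occurrences (box_factor k) w) \<le> downs w \<and>
    (downs w = (k + 2) * card (factor_occurrences (box_factor k) w) \<longrightarrow>
      (\<exists>as c. w = blocks k as @ replicate c U \<and>
        length as = card (factor_occurrences (box_factor k) w)))"
  using assms
proof (induction w rule: length_induct)
  case (1 w)
  let ?occ = "\<lambda>w. card (factor_occurrences (box_factor k) w)"
  have IH: "(k + 2) * ?occ v \<le> downs v \<and>
      (downs v = (k + 2) * ?occ v \<longrightarrow>
        (\<exists>as c. v = blocks k as @ replicate c U \<and> length as = ?occ v))"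
    if "w = u @ v" "u \<noteq> []" for u v
  proof -
    have "length v < length w" "v = [] \<or> last v \<noteq> L"
      using that 1 by auto
    moreover have "\<not> sublist [L, U] v"
      using that 1 by (auto simp: sublist_append)
    ultimately show ?thesis
      using 1(1) by blast
  qed
  consider "w = []" | x v where "w = x # v" "x \<noteq> U"
    | v where "w = U # v" "\<not> prefix (box_factor k) w"
    | v where "w = U # replicate k D @ L # v"
  proof (cases w)
    case (Cons x v)
    then show ?thesis
      using that by (cases "prefix (box_factor k) w"; cases "x = U") (auto simp: prefix_def)
  qed (use that in auto)
  then show ?case
  proof cases
    assume "w = []"
    then show ?thesis
      by (auto simp: card_factor_occurrences_Nil intro!: exI[of _ 0])
  next
    fix x v assume "w = x # v" "x \<noteq> U"
    then show ?thesis
      using IH[of "[x]" v] by (simp add: card_box_factor_down)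
  next
    fix v assume w: "w = U # v" "\<not> prefix (box_factor k) w"
    then have occ: "?occ w = ?occ v" and downs: "downs w = downs v"
      by (simp_all add: card_factor_occurrences_Cons)
    \<comment> \<open>A U that starts no occurrence lengthens the first ascent of the rest, or the
      trailing run if no block is left.\<close>
    have "\<exists>as' c'. U # blocks k as @ replicate c U = blocks k as' @ replicate c' U \<and>
        length as' = length as" for as c
    proof (cases as)
      case Nil
      then show ?thesis
        by (intro exI[of _ "[]"] exI[of _ "Suc c"]) simp
    next
      case (Cons a as')
      then show ?thesis
        by (intro exI[of _ "Suc a # as'"] exI[of _ c]) (simp add: block_def)
    qed
    then show ?thesis
      using IH[of "[U]" v] w(1) unfolding occ downs by fastforce
  next
    fix v assume w: "w = U # replicate k D @ L # v"
    have "v \<noteq> []"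
      using w 1(3) by auto
    then obtain y v' where v: "v = y # v'"
      by (cases v) auto
    have LU: "\<not> sublist [L, U] (L # y # v')"
      using 1(2) w v by (auto simp: sublist_append sublist_Cons_right)
    then have "y \<noteq> U"
      by (auto simp: sublist_Cons_right)
    have occ: "?occ w = Suc (?occ v')"
      using \<open>y \<noteq> U\<close> by (simp add: w v card_box_factor_U_Cons card_box_factor_down)
    have downs: "downs w = k + 2 + downs v'"
      using \<open>y \<noteq> U\<close> by (simp add: w v)
    have v': "(k + 2) * ?occ v' \<le> downs v'"
      "downs v' = (k + 2) * ?occ v' \<Longrightarrow>
        \<exists>as c. v' = blocks k as @ replicate c U \<and> length as = ?occ v'"
      using IH[of "U # replicate k D @ [L, y]" v'] w v by auto
    have "\<exists>as c. w = blocks k as @ replicate c U \<and> length as = ?occ w"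
      if "downs w = (k + 2) * ?occ w"
    proof -
      have "downs v' = (k + 2) * ?occ v'"
        using that unfolding occ downs by simp
      then obtain as c where as: "v' = blocks k as @ replicate c U" "length as = ?occ v'"
        using v'(2) by blast
      \<comment> \<open>If y = L, it is not the last letter; by equality the rest consists of blocks
        and U's, hence starts with U and produces a forbidden LU.\<close>
      have "y \<noteq> L"
      proof
        assume "y = L"
        then have "v' \<noteq> []"
          using 1(3) w v by auto
        then have "hd v' = U"
          using as(1) hd_blocks[of as k] by (cases "as = []"; cases c) auto
        then show False
          using LU \<open>y = L\<close> \<open>v' \<noteq> []\<close> by (cases v') (auto simp: sublist_Cons_right)
      qed
      then have "y = D"
        using \<open>y \<noteq> U\<close> by (cases y) auto
      then show ?thesis
        using as by (intro exI[of _ "0 # as"] exI[of _ c]) (simp add: occ, simp add: w v block_def)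
    qed
    then show ?thesis
      using v'(1) unfolding occ downs by simp
  qed
qed

section \<open>Heights along words of blocks and the characterisation of box paths\<close>

text \<open>Within the ascent the height is nonnegative; later at least one down step of the block
  is still missing, hence the + 1. It offsets the -1 at which the last block ends.\<close>

lemma height_strict_prefix_block:
  assumes "strict_prefix p (block k a)"
  shows "0 \<le> height p \<or> excess k a + 1 \<le> height p"
proof -
  let ?d = "replicate k D @ [L, D]"
  from assms have "prefix p (replicate (Suc a) U @ ?d)"
    by (simp add: block_def strict_prefix_def)
  then consider "prefix p (replicate (Suc a) U)" | q where "p = replicate (Suc a) U @ q"
    unfolding prefix_append by blast
  then show ?thesis
  proof cases
    case 1
    then have "set p \<subseteq> {U}"
      using set_mono_prefix by fastforce
    then have "p = replicate (length p) U"
      by (intro replicate_eqI) auto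
    then have "height p = int (length p)"
      by (metis height_simps(4))
    then show ?thesis
      by simp
  next
    case 2
    then obtain r where r: "?d = q @ r" "r \<noteq> []"
      using assms by (auto simp: block_def strict_prefix_def prefix_def)
    have "set r \<subseteq> set ?d"
      unfolding r by simp
    moreover have "U \<notin> set ?d"
      by simp
    ultimately have "U \<notin> set r"
      by blast
    then have "height r < 0"
      using r(2) by (simp add: height_def downs_eq_length)
    moreover have "excess k a = height p + height r"
      unfolding height_block[symmetric] block_def 2 r(1) by simp
    ultimately show ?thesis
      by simp
  qed
qed

text \<open>The initial height \<open>h\<close> lets the induction pass to the tail. Only the end of
  the whole word may have height -1, and strict prefixes do not reach it.\<close>

lemma height_strict_prefix_blocks:
  assumes "\<And>i. i < length as \<Longrightarrow> 0 \<le> h + sum_list (map (excess k) (take i as))"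
    and "-1 \<le> h + sum_list (map (excess k) as)"
    and "strict_prefix p (blocks k as)"
  shows "0 \<le> h + height p"
  using assms
proof (induction as arbitrary: h p)
  case Nil
  then show ?case
    by simp
next
  case (Cons a as)
  have h: "0 \<le> h"
    using Cons.prems(1)[of 0] by simp
  have h': "0 \<le> h + excess k a + sum_list (map (excess k) (take i as))" if "i < length as" for i
    using Cons.prems(1)[of "Suc i"] that by simp
  have last: "-1 \<le> h + excess k a + sum_list (map (excess k) as)"
    using Cons.prems(2) by simp
  \<comment> \<open>After the first block the height is nonnegative if blocks follow and at least -1
    otherwise.\<close>
  have ge: "-1 \<le> h + excess k a"
    using h'[of 0] last by (cases as) auto
  from Cons.prems(3) have "prefix p (block k a @ blocks k as)" "p \<noteq> block k a @ blocks k as"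
    by (auto simp: strict_prefix_def)
  then consider "strict_prefix p (block k a)" | q where "p = block k a @ q" "strict_prefix q (blocks k as)"
    | "p = block k a" "as \<noteq> []"
    unfolding prefix_append strict_prefix_def by fastforce
  then show ?case
  proof cases
    case 1
    then show ?thesis
      using height_strict_prefix_block[OF 1] h ge by linarith
  next
    case 2
    then show ?thesis
      using Cons.IH[OF h' last 2(2)] by (simp add: height_block)
  next
    case 3
    then show ?thesis
      using h'[of 0] by (simp add: height_block)
  qed
qed

lemma skew_dyck_path_iff_height:
  "skew_dyck_path w \<longleftrightarrow> \<not> sublist [U, L] w \<and> \<not> sublist [L, U] w \<and> height w = 0 \<and>
    (\<forall>p. prefix p w \<longrightarrow> 0 \<le> height p)"
  by (auto simp: skew_dyck_path_def height_def downs_def)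

text \<open>Forwards, \<open>w @ [D]\<close> is in the equality case of
  \<open>box_factors_le_downs\<close>. Backwards, a prefix of \<open>w\<close> is a strict prefix of
  the word of blocks, so \<open>height_strict_prefix_blocks\<close> applies.\<close>

lemma box_path_iff_blocks:
  assumes "k \<ge> 1" "n \<ge> 1"
  shows "box_path k n w \<longleftrightarrow>
    (\<exists>as. length as = n \<and> sum_list as = (k + 1) * n - 1 \<and>
      nonneg_partial_sums (excess k) as \<and> w @ [D] = blocks k as)"
proof
  assume bp: "box_path k n w"
  then have "\<not> sublist [L, U] w" and h0: "height w = 0"
    and pos: "\<And>p. prefix p w \<Longrightarrow> 0 \<le> height p"
    by (auto simp: box_path_def skew_dyck_path_iff_height)
  then have "\<not> sublist [L, U] (w @ [D])"
    by (simp add: not_sublist_pair_iff successively_append_iff)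
  moreover have occ: "card (factor_occurrences (box_factor k) (w @ [D])) = n"
    using bp by (simp add: box_path_def card_factor_occurrences_snoc)
  \<comment> \<open>A path has as many down steps as up steps, (k+2)n - 1, and the appended D adds
    one.\<close>
  moreover have "downs (w @ [D]) = (k + 2) * n"
  proof -
    have "int (downs w) = int ((k + 2) * n - 1)"
      using h0 bp by (simp add: height_def box_path_def semilength_def)
    moreover have "(k + 2) * n \<ge> 1"
      using assms by simp
    ultimately show ?thesis
      by simp
  qed
  ultimately obtain as c where as: "w @ [D] = blocks k as @ replicate c U" "length as = n"
    using box_factors_le_downs[of "w @ [D]" k] by auto
  have "c = 0"
  proof (rule ccontr)
    assume "c \<noteq> 0"
    then have "last (w @ [D]) = U"
      unfolding as(1) by simp
    then show False
      by simp
  qed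
  with as have wD: "w @ [D] = blocks k as"
    by simp
  have "sum_list (map (excess k) as) = -1"
    using h0 by (simp flip: height_blocks wD)
  then have "int (sum_list as + 1) = int ((k + 1) * n)"
    using as(2) unfolding sum_list_excess by simp
  then have "sum_list as = (k + 1) * n - 1"
    by (metis add_diff_cancel_right' of_nat_eq_iff)
  moreover have "nonneg_partial_sums (excess k) as"
    unfolding nonneg_partial_sums_def
  proof (intro allI impI)
    fix i assume i: "i < length as"
    have split: "w @ [D] = blocks k (take i as) @ blocks k (drop i as)"
      unfolding wD by (metis append_take_drop_id concat_append map_append)
    \<comment> \<open>A nonempty rest means that the boundary before it lies in \<open>w\<close>
      itself, where the path condition holds.\<close>
    have "blocks k (drop i as) \<noteq> []"
      using i hd_blocks[of "drop i as" k] by simp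
    then obtain v x where "blocks k (drop i as) = v @ [x]"
      by (meson rev_exhaust)
    then have "prefix (blocks k (take i as)) w"
      using split by simp
    then show "0 \<le> sum_list (map (excess k) (take i as))"
      using pos by (simp flip: height_blocks)
  qed
  ultimately show "\<exists>as. length as = n \<and> sum_list as = (k + 1) * n - 1 \<and>
      nonneg_partial_sums (excess k) as \<and> w @ [D] = blocks k as"
    using as(2) wD by blast
next
  assume "\<exists>as. length as = n \<and> sum_list as = (k + 1) * n - 1 \<and>
      nonneg_partial_sums (excess k) as \<and> w @ [D] = blocks k as"
  then obtain as where as: "length as = n" "sum_list as = (k + 1) * n - 1"
    "nonneg_partial_sums (excess k) as" "w @ [D] = blocks k as"
    by blast
  \<comment> \<open>This keeps the subtraction (k+1)n - 1 on naturals from being truncated.\<close>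
  have "(k + 1) * n \<ge> 1"
    using assms by simp
  then have total: "sum_list (map (excess k) as) = -1"
    using as unfolding sum_list_excess by simp
  have "sublist w (blocks k as)"
    unfolding as(4)[symmetric] by (rule sublist_append_rightI)
  then have "\<not> sublist [U, L] w" "\<not> sublist [L, U] w"
    using sublist_pair_blocks[OF assms(1)] sublist_order.order.trans by blast+
  moreover have "height w = 0"
    using total by (simp flip: height_blocks as(4))
  moreover have "0 \<le> height p" if "prefix p w" for p
  proof -
    have "strict_prefix p (blocks k as)"
      using that by (auto simp flip: as(4) simp: strict_prefix_def prefix_def)
    then show ?thesis
      using height_strict_prefix_blocks[of as 0 k p] as(3) total
      by (simp add: nonneg_partial_sums_def)
  qed
  ultimately have "skew_dyck_path w"
    by (simp add: skew_dyck_path_iff_height)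
  moreover have "semilength w = (k + 2) * n - 1"
  proof -
    have "semilength w = count_list (w @ [D]) U"
      by (simp add: semilength_def)
    also have "\<dots> = (k + 1) * n - 1 + n"
      unfolding as(4) count_U_blocks by (simp add: as)
    also have "\<dots> = (k + 2) * n - 1"
      using \<open>(k + 1) * n \<ge> 1\<close> by (simp add: algebra_simps)
    finally show ?thesis .
  qed
  moreover have "card (factor_occurrences (box_factor k) w) = n"
    using card_factor_occurrences_snoc[of "box_factor k" D w] card_box_factor_blocks[of k as] as
    by simp
  ultimately show "box_path k n w"
    by (simp add: box_path_def)
qed

section \<open>Long ascents of words of blocks and the final count\<close>

lemma card_long_ascents_replicate_D:
  "card (long_ascents (replicate m D @ w)) = card (long_ascents w)"
  by (induction m) (simp_all add: card_long_ascents_Cons)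

lemma card_long_ascents_block:
  "card (long_ascents (block k a @ w)) = (if a = 0 then 0 else 1) + card (long_ascents w)"
proof -
  obtain x v where v: "replicate k D @ [L, D] @ w = x # v" "x \<noteq> U"
    by (cases k) auto
  have "card (long_ascents (x # v)) = card (long_ascents w)"
    by (simp flip: v(1) add: card_long_ascents_replicate_D card_long_ascents_Cons)
  then show ?thesis
    using card_long_ascents_replicate[OF v(2), of a v] v(1) by (simp add: block_def)
qed

lemma card_long_ascents_blocks: "card (long_ascents (blocks k as)) = num_nonzero as"
  by (induction as) (simp_all add: card_long_ascents_block card_long_ascents_Nil)

text \<open>The leading run of U's, closed by a D or L, determines the first entry; the rest of the
  block is fixed and cancels.\<close>

lemma inj_blocks: "inj (blocks k)"
proof (rule injI)
  show "as = bs" if "blocks k as = blocks k bs" for as bs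
    using that
  proof (induction as arbitrary: bs)
    case Nil
    then show ?case
      using hd_blocks[of bs k] by auto
  next
    case (Cons a as)
    then obtain b bs' where bs: "bs = b # bs'"
      using hd_blocks[of "a # as" k] by (cases bs) auto
    have nU: "hd (replicate k D @ [L, D] @ v) \<noteq> U" for v
      by (cases k) auto
    have "replicate (Suc a) U @ (replicate k D @ [L, D] @ blocks k as) =
        replicate (Suc b) U @ (replicate k D @ [L, D] @ blocks k bs')"
      using Cons.prems by (simp only: bs list.map concat.simps block_append)
    then have "Suc a = Suc b \<and>
        replicate k D @ [L, D] @ blocks k as = replicate k D @ [L, D] @ blocks k bs'"
      by (rule replicate_append_eqD) (use nU in blast)+
    then show ?case
      using Cons.IH bs by simp
  qed
qed

text \<open>Appending D and \<open>blocks k\<close> are both injective, and the two sets have the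
  same image under them.\<close>

lemma card_box_paths_eq:
  assumes "k \<ge> 1" "n \<ge> 1"
  shows "card {w. box_path k n w \<and> card (long_ascents w) = j} =
    card {as \<in> weak_comps n ((k + 1) * n - 1) j. nonneg_partial_sums (excess k) as}"
    (is "card ?P = card ?C")
proof -
  have long: "card (long_ascents w) = num_nonzero as" if "w @ [D] = blocks k as" for w as
    using card_long_ascents_snoc[of D w] that by (simp add: card_long_ascents_blocks)
  have "(\<lambda>w. w @ [D]) ` ?P = blocks k ` ?C"
  proof (intro set_eqI iffI)
    fix v assume "v \<in> (\<lambda>w. w @ [D]) ` ?P"
    then show "v \<in> blocks k ` ?C"
      using assms long by (auto simp: box_path_iff_blocks weak_comps_def)
  next
    fix v assume "v \<in> blocks k ` ?C"
    then obtain as where as: "v = blocks k as" "as \<in> ?C"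
      by blast
    then have "as \<noteq> []"
      using assms by (auto simp: weak_comps_def)
    then have v: "v = butlast v @ [D]"
      using as(1) hd_blocks[of as k] last_blocks[of as k] by (metis append_butlast_last_id)
    then have "butlast v \<in> ?P"
      using as long[of "butlast v" as] assms by (auto simp: box_path_iff_blocks weak_comps_def)
    then show "v \<in> (\<lambda>w. w @ [D]) ` ?P"
      using v by blast
  qed
  moreover have "card ((\<lambda>w. w @ [D]) ` ?P) = card ?P"
    by (rule card_image) (simp add: inj_on_def)
  moreover have "card (blocks k ` ?C) = card ?C"
    by (rule card_image) (rule inj_on_subset[OF inj_blocks subset_UNIV])
  ultimately show ?thesis
    by simp
qed

theorem theorem7p2:
  fixes k n j :: nat
  assumes "k \<ge> 1" and "n \<ge> 1" and "1 \<le> j" and "j \<le> n"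
  shows "real (card {w. box_path k n w \<and> card (long_ascents w) = j}) =
    1 / real j * real (((k + 1) * n - 2) choose (j - 1)) * real ((n - 1) choose (j - 1))"
proof -
  define N where "N = (k + 1) * n - 2"
  define X where "X = card {w. box_path k n w \<and> card (long_ascents w) = j}"
  let ?A = "weak_comps n (Suc N) j"
  \<comment> \<open>With (k+1)n >= 2 the subtraction in \<open>N\<close> is exact, so
    \<open>Suc N\<close> is the required sum (k+1)n - 1.\<close>
  have "(k + 1) * n \<ge> 2 * 1"
    using assms by (intro mult_le_mono) auto
  then have N: "(k + 1) * n = N + 2"
    by (simp add: N_def)
  have "card ?A = n * card {as \<in> ?A. nonneg_partial_sums (excess k) as}"
  proof (rule cycle_lemma)
    fix as assume as: "as \<in> ?A"
    then show "sum_list (map (excess k) as) = -1"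
      unfolding sum_list_excess using N by (simp add: weak_comps_def)
  qed (simp_all add: weak_comps_rotate, simp add: weak_comps_def)
  also have "card {as \<in> ?A. nonneg_partial_sums (excess k) as} = X"
    using card_box_paths_eq[OF assms(1,2), of j] N by (simp add: X_def)
  finally have "n * X = (n choose j) * (N choose (j - 1))"
    using card_weak_comps[of n N "j - 1"] assms(3) by simp
  \<comment> \<open>Multiplying by j lets the absorption identity expose a factor n, which then
    cancels without division.\<close>
  then have "n * (j * X) = j * (n choose j) * (N choose (j - 1))"
    by (simp add: algebra_simps)
  also have "j * (n choose j) = n * ((n - 1) choose (j - 1))"
    using assms by (simp add: times_binomial_minus1_eq)
  finally have "j * X = (N choose (j - 1)) * ((n - 1) choose (j - 1))"
    using assms by simp
  then have "real j * real X = real (N choose (j - 1)) * real ((n - 1) choose (j - 1))"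
    by (metis of_nat_mult)
  then show ?thesis
    using assms unfolding X_def[symmetric] N_def[symmetric] by (simp add: field_simps)
qed

end
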